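(* Let $n$ be a positive integer, let $\mathbf{MV}_n$ be the $n+1$-valued Łukasiewicz logic, and let $\mathbf{K}'_n$ be the smallest set of formulas of $\mathsf{Form}$ that is closed under modus ponens, uniform substitution and the necessitation rule (from $\phi$ infer $\square\phi$) and that contains $\mathbf{MV}_n$ together with the three formulas $$\square(p\to q)\to(\square p\to\square q),\qquad \square(p\oplus p)\leftrightarrow(\square p\oplus\square p),\qquad \square(p\odot p)\leftrightarrow(\square p\odot\square p).$$ Then $\mathbf{K}_n=\mathbf{K}'_n$.
   Context: Formulas: let $\mathsf{Prop}$ be an infinite set of propositional variables. $\mathsf{Form}$ is the smallest set containing $\mathsf{Prop}$ and containing $\neg\phi$, $\phi\oplus\psi$, $\square\phi$ whenever it contains $\phi,\psi$. Abbreviations: $\phi\to\psi$ is $\psi\oplus\neg\phi$; $\psi\odot\phi$ is $\neg(\neg\psi\oplus\neg\phi)$; $\phi\leftrightarrow\psi$ is $(\phi\to\psi)\odot(\psi\to\phi)$; $\phi^m$ is $\phi\odot\cdots\odot\phi$ ($m$ factors). The $n+1$-valued Łukasiewicz logic $\mathbf{MV}_n$ is the set of $\square$-free formulas that take the value $1$ under every assignment to the variables of values in $\text{Ł}_n=\{0,\frac1n,\ldots,\frac{n-1}{n},1\}$, where $x\oplus y=\min(x+y,1)$ and $\neg x=1-x$. A modal many-valued logic is a set $\mathbf{L}\subseteq\mathsf{Form}$ closed under modus ponens, uniform substitution, and the necessitation rule (from $\phi$ infer $\square\phi$), and containing: (i) $p\to(q\to p)$, $(p\to q)\to((q\to r)\to(p\to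 r))$, $((p\to q)\to q)\to((q\to p)\to p)$, $(\neg p\to\neg q)\to(q\to p)$ (an axiomatic base of infinite-valued Łukasiewicz logic); (ii) $\square(p\to q)\to(\square p\to\square q)$; (iii) $\square(p\oplus p)\leftrightarrow\square p\oplus\square p$ and $\square(p\odot p)\leftrightarrow\square p\odot\square p$; (iv) $\square(p\oplus p^m)\leftrightarrow(\square p\oplus(\square p)^m)$ for every positive integer $m$. $\mathbf{K}_n$ is the smallest modal many-valued logic that also contains an axiomatic base of the $n+1$-valued Łukasiewicz logic $\mathbf{MV}_n$. *)

theory Defs
  imports Complex_Main
begin

datatype 'v form =
    Var 'v
  | Neg "'v form" ("\<^bold>\<not> _" [80] 80)
  | Oplus "'v form" "'v form" (infixr "\<oplus>" 65)
  | Box "'v form" ("\<box> _" [80] 80)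

abbreviation Imp :: "'v form \<Rightarrow> 'v form \<Rightarrow> 'v form" (infixr "\<^bold>\<rightarrow>" 55) where
  "\<phi> \<^bold>\<rightarrow> \<psi> \<equiv> \<psi> \<oplus> \<^bold>\<not> \<phi>"

abbreviation Odot :: "'v form \<Rightarrow> 'v form \<Rightarrow> 'v form" (infixr "\<odot>" 70) where
  "\<psi> \<odot> \<phi> \<equiv> \<^bold>\<not> (\<^bold>\<not> \<psi> \<oplus> \<^bold>\<not> \<phi>)"

abbreviation Iff :: "'v form \<Rightarrow> 'v form \<Rightarrow> 'v form" (infix "\<^bold>\<leftrightarrow>" 54) where
  "\<phi> \<^bold>\<leftrightarrow> \<psi> \<equiv> (\<phi> \<^bold>\<rightarrow> \<psi>) \<odot> (\<psi> \<^bold>\<rightarrow> \<phi>)"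

text \<open>The formula \<open>\<phi> \<odot> (\<phi> \<odot> (\<dots> \<odot> \<phi>))\<close> with \<open>m\<close> factors; only meaningful for \<open>m \<ge> 1\<close>.\<close>

definition opow :: "'v form \<Rightarrow> nat \<Rightarrow> 'v form" where
  "opow \<phi> m = ((\<lambda>\<psi>. \<phi> \<odot> \<psi>) ^^ (m - 1)) \<phi>"

primrec subst :: "('v \<Rightarrow> 'v form) \<Rightarrow> 'v form \<Rightarrow> 'v form" where
  "subst \<sigma> (Var p) = \<sigma> p"
| "subst \<sigma> (\<^bold>\<not> \<phi>) = \<^bold>\<not> subst \<sigma> \<phi>"
| "subst \<sigma> (\<phi> \<oplus> \<psi>) = subst \<sigma> \<phi> \<oplus> subst \<sigma> \<psi>"
| "subst \<sigma> (\<box> \<phi>) = \<box> subst \<sigma> \<phi>"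

primrec box_free :: "'v form \<Rightarrow> bool" where
  "box_free (Var p) = True"
| "box_free (\<^bold>\<not> \<phi>) = box_free \<phi>"
| "box_free (\<phi> \<oplus> \<psi>) = (box_free \<phi> \<and> box_free \<psi>)"
| "box_free (\<box> \<phi>) = False"

definition Luk :: "nat \<Rightarrow> real set" where
  "Luk n = {real i / real n | i. i \<le> n}"

text \<open>Only used on box-free formulas, hence the unspecified value on boxes.\<close>

primrec val :: "('v \<Rightarrow> real) \<Rightarrow> 'v form \<Rightarrow> real" where
  "val v (Var p) = v p"
| "val v (\<^bold>\<not> \<phi>) = 1 - val v \<phi>"
| "val v (\<phi> \<oplus> \<psi>) = min (val v \<phi> + val v \<psi>) 1"
| "val v (\<box> \<phi>) = undefined"

definition MV :: "nat \<Rightarrow> 'v form set" where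
  "MV n = {\<phi>. box_free \<phi> \<and> (\<forall>v. (\<forall>p. v p \<in> Luk n) \<longrightarrow> val v \<phi> = 1)}"

definition closed_mp :: "'v form set \<Rightarrow> bool" where
  "closed_mp L \<longleftrightarrow> (\<forall>\<phi> \<psi>. \<phi> \<in> L \<longrightarrow> (\<phi> \<^bold>\<rightarrow> \<psi>) \<in> L \<longrightarrow> \<psi> \<in> L)"

definition closed_subst :: "'v form set \<Rightarrow> bool" where
  "closed_subst L \<longleftrightarrow> (\<forall>\<phi> \<sigma>. \<phi> \<in> L \<longrightarrow> subst \<sigma> \<phi> \<in> L)"

definition closed_nec :: "'v form set \<Rightarrow> bool" where
  "closed_nec L \<longleftrightarrow> (\<forall>\<phi>. \<phi> \<in> L \<longrightarrow> \<box> \<phi> \<in> L)"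

text \<open>
  The propositional consequences of a set of axioms: the language here is the box-free one, so
  only box-free formulas may be substituted for variables.
\<close>

definition prop_theorems :: "'v form set \<Rightarrow> 'v form set" where
  "prop_theorems B = \<Inter> {S. B \<subseteq> S \<and> closed_mp S \<and>
     (\<forall>\<phi> \<sigma>. \<phi> \<in> S \<longrightarrow> (\<forall>p. box_free (\<sigma> p)) \<longrightarrow> subst \<sigma> \<phi> \<in> S)}"

definition axiomatic_base :: "nat \<Rightarrow> 'v form set \<Rightarrow> bool" where
  "axiomatic_base n B \<longleftrightarrow> prop_theorems B = MV n"

text \<open>
  The letters of an axiom are distinct variables. Which ones is immaterial for logics closed under
  substitution, so each axiom is taken together with its variable renamings.
\<close>

definition luk_axioms :: "'v form set" where
  "luk_axioms =
     {Var p \<^bold>\<rightarrow> (Var q \<^bold>\<rightarrow> Var p) | p q. p \<noteq> q}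
   \<union> {(Var p \<^bold>\<rightarrow> Var q) \<^bold>\<rightarrow> ((Var q \<^bold>\<rightarrow> Var r) \<^bold>\<rightarrow> (Var p \<^bold>\<rightarrow> Var r)) | p q r. distinct [p, q, r]}
   \<union> {((Var p \<^bold>\<rightarrow> Var q) \<^bold>\<rightarrow> Var q) \<^bold>\<rightarrow> ((Var q \<^bold>\<rightarrow> Var p) \<^bold>\<rightarrow> Var p) | p q. p \<noteq> q}
   \<union> {(\<^bold>\<not> Var p \<^bold>\<rightarrow> \<^bold>\<not> Var q) \<^bold>\<rightarrow> (Var q \<^bold>\<rightarrow> Var p) | p q. p \<noteq> q}"

definition K_axioms :: "'v form set" where
  "K_axioms = {\<box> (Var p \<^bold>\<rightarrow> Var q) \<^bold>\<rightarrow> (\<box> Var p \<^bold>\<rightarrow> \<box> Var q) | p q. p \<noteq> q}"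

definition double_axioms :: "'v form set" where
  "double_axioms =
     {\<box> (Var p \<oplus> Var p) \<^bold>\<leftrightarrow> (\<box> Var p \<oplus> \<box> Var p) | p. True}
   \<union> {\<box> (Var p \<odot> Var p) \<^bold>\<leftrightarrow> (\<box> Var p \<odot> \<box> Var p) | p. True}"

definition power_axioms :: "'v form set" where
  "power_axioms =
     {\<box> (Var p \<oplus> opow (Var p) m) \<^bold>\<leftrightarrow> (\<box> Var p \<oplus> opow (\<box> Var p) m) | p m. m \<ge> 1}"

definition modal_mv_logic :: "'v form set \<Rightarrow> bool" where
  "modal_mv_logic L \<longleftrightarrow> closed_mp L \<and> closed_subst L \<and> closed_nec L \<and>
     luk_axioms \<subseteq> L \<and> K_axioms \<subseteq> L \<and> double_axioms \<subseteq> L \<and> power_axioms \<subseteq> L"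

text \<open>The smallest modal many-valued logic containing \<open>B\<close>, to be used with a base \<open>B\<close> of \<open>MV n\<close>.\<close>

definition K_logic :: "'v form set \<Rightarrow> 'v form set" where
  "K_logic B = \<Inter> {L. modal_mv_logic L \<and> B \<subseteq> L}"

definition K'_logic :: "nat \<Rightarrow> 'v form set" where
  "K'_logic n = \<Inter> {L. closed_mp L \<and> closed_subst L \<and> closed_nec L \<and>
     MV n \<subseteq> L \<and> K_axioms \<subseteq> L \<and> double_axioms \<subseteq> L}"

text \<open>The intersections above are indeed least elements, and every \<open>MV n\<close> has an axiomatic base.\<close>

lemma modal_mv_logic_K_logic: "modal_mv_logic (K_logic B)" and K_logic_base: "B \<subseteq> K_logic B"
  unfolding K_logic_def modal_mv_logic_def closed_mp_def closed_subst_def closed_nec_def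
  by blast+

lemma K'_logic_closed:
  "closed_mp (K'_logic n)" "closed_subst (K'_logic n)" "closed_nec (K'_logic n)"
  "MV n \<subseteq> K'_logic n" "K_axioms \<subseteq> K'_logic n" "double_axioms \<subseteq> K'_logic n"
  unfolding K'_logic_def closed_mp_def closed_subst_def closed_nec_def by blast+

lemma val_subst: "box_free \<phi> \<Longrightarrow> val v (subst \<sigma> \<phi>) = val (\<lambda>p. val v (\<sigma> p)) \<phi>"
  by (induction \<phi>) auto

lemma box_free_subst: "box_free \<phi> \<Longrightarrow> (\<And>p. box_free (\<sigma> p)) \<Longrightarrow> box_free (subst \<sigma> \<phi>)"
  by (induction \<phi>) auto

lemma val_in_Luk:
  assumes "n \<ge> 1" "\<And>p. v p \<in> Luk n"
  shows "box_free \<phi> \<Longrightarrow> val v \<phi> \<in> Luk n"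
proof (induction \<phi>)
  case (Neg \<phi>)
  then obtain i where i: "i \<le> n" "val v \<phi> = real i / real n" by (auto simp: Luk_def)
  then have "val v (\<^bold>\<not> \<phi>) = real (n - i) / real n"
    using assms(1) by (simp add: of_nat_diff diff_divide_distrib)
  then show ?case by (auto simp: Luk_def)
next
  case (Oplus \<phi> \<psi>)
  then obtain i j where ij: "val v \<phi> = real i / real n" "val v \<psi> = real j / real n"
    by (auto simp: Luk_def)
  then have "val v (\<phi> \<oplus> \<psi>) = real (min (i + j) n) / real n"
    using assms(1) by (cases "i + j \<le> n") (simp_all add: min_def add_divide_distrib[symmetric])
  then show ?case unfolding Luk_def by (metis (mono_tags, lifting) mem_Collect_eq min.cobounded2)
qed (use assms in auto)

lemma axiomatic_base_MV:
  assumes "n \<ge> 1"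
  shows "axiomatic_base n (MV n :: 'v form set)"
proof -
  have "closed_mp (MV n :: 'v form set)"
    unfolding closed_mp_def
  proof (intro allI impI)
    fix \<phi> \<psi> :: "'v form"
    assume *: "\<phi> \<in> MV n" "(\<phi> \<^bold>\<rightarrow> \<psi>) \<in> MV n"
    have "val v \<psi> = 1" if v: "\<forall>p. v p \<in> Luk n" for v
    proof -
      have "val v \<psi> \<in> Luk n" using * v val_in_Luk[OF assms] by (auto simp: MV_def)
      then have "val v \<psi> \<le> 1" using assms by (auto simp: Luk_def)
      moreover have "val v \<phi> = 1" "val v (\<phi> \<^bold>\<rightarrow> \<psi>) = 1" using * v by (auto simp: MV_def)
      ultimately show ?thesis by simp
    qed
    then show "\<psi> \<in> MV n" using * by (auto simp: MV_def)
  qed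
  moreover have "subst \<sigma> \<phi> \<in> MV n" if "\<phi> \<in> MV n" "\<forall>p. box_free (\<sigma> p)" for \<sigma> and \<phi> :: "'v form"
    using that by (auto simp: MV_def val_subst box_free_subst val_in_Luk[OF assms])
  ultimately show ?thesis
    unfolding axiomatic_base_def prop_theorems_def by blast
qed

end

theory Submission
  imports Defs
begin

text \<open>
  The logic of a base contains all of \<open>MV n\<close> because a set closed under modus ponens and
  substitution contains every propositional consequence of its elements. As the Lukasiewicz axioms
  and the base belong to \<open>MV n\<close>, what remains is to derive the power axioms in \<open>K'_logic n\<close>.

  For the power axioms, composing the maps \<open>x \<mapsto> x \<oplus> x\<close> and \<open>x \<mapsto> x \<odot> x\<close> on
  \<open>[0,1]\<close> yields, for all \<open>a < 2^k\<close>, the function that truncates \<open>2^k x - a\<close> to \<open>[0,1]\<close>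
  (\<open>eval_dyadic\<close>). For large \<open>k\<close> and suitable \<open>a\<close> this function, restricted to the \<open>n + 1\<close> truth
  values, is the characteristic function of \<open>{x. x > i/n}\<close>. So each such threshold is given by a term
  which commutes with the box by the two doubling axioms (\<open>dyadic_commutes\<close>).

  Let \<open>t\<close> be a term whose truth function \<open>g\<close> is monotone with \<open>g 0 = 0\<close> and \<open>g 1 = 1\<close>. For every
  \<open>i < n\<close> there is \<open>j < n\<close> such that \<open>g x > i/n\<close> iff \<open>x > j/n\<close>, so that, writing \<open>\<tau>\<^sub>i\<close> for the
  threshold terms,
  \<open>\<tau>\<^sub>i (\<box> t \<phi>) \<leftrightarrow> \<box> \<tau>\<^sub>i (t \<phi>) \<leftrightarrow> \<box> \<tau>\<^sub>j \<phi> \<leftrightarrow> \<tau>\<^sub>j (\<box> \<phi>) \<leftrightarrow> \<tau>\<^sub>i (t (\<box> \<phi>))\<close>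
  are all derivable. As a truth value is determined by the thresholds it exceeds, the box commutes
  with \<open>t\<close> (\<open>monotone_term_commutes\<close>). The truth function of \<open>p \<oplus> p^m\<close> has the required properties.

  The propositional reasoning is done semantically, with boxed formulas treated as atoms: the logic
  is closed under finitary \<open>n + 1\<close>-valued consequence (\<open>consequence_closed\<close>).
\<close>

section \<open>Valuations of modal formulas with boxes as atoms\<close>

text \<open>The truth value of a formula when the variables and the boxed formulas are assigned values
  by \<open>w\<close>, which is only consulted on formulas of these two kinds.\<close>

primrec eval :: "('v form \<Rightarrow> real) \<Rightarrow> 'v form \<Rightarrow> real" where
  "eval w (Var p) = w (Var p)"
| "eval w (\<^bold>\<not> \<phi>) = 1 - eval w \<phi>"
| "eval w (\<phi> \<oplus> \<psi>) = min (eval w \<phi> + eval w \<psi>) 1"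
| "eval w (\<box> \<phi>) = w (\<box> \<phi>)"

text \<open>The variables and boxed formulas from which a formula is built propositionally.\<close>

primrec atoms :: "'v form \<Rightarrow> 'v form set" where
  "atoms (Var p) = {Var p}"
| "atoms (\<^bold>\<not> \<phi>) = atoms \<phi>"
| "atoms (\<phi> \<oplus> \<psi>) = atoms \<phi> \<union> atoms \<psi>"
| "atoms (\<box> \<phi>) = {\<box> \<phi>}"

text \<open>The box-free formula obtained by replacing every atom \<open>a\<close> by the variable \<open>f a\<close>.\<close>

primrec skeleton :: "('v form \<Rightarrow> 'v) \<Rightarrow> 'v form \<Rightarrow> 'v form" where
  "skeleton f (Var p) = Var (f (Var p))"
| "skeleton f (\<^bold>\<not> \<phi>) = \<^bold>\<not> skeleton f \<phi>"
| "skeleton f (\<phi> \<oplus> \<psi>) = skeleton f \<phi> \<oplus> skeleton f \<psi>"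
| "skeleton f (\<box> \<phi>) = Var (f (\<box> \<phi>))"

lemma finite_atoms: "finite (atoms \<phi>)"
  by (induction \<phi>) auto

lemma box_free_skeleton: "box_free (skeleton f \<phi>)"
  by (induction \<phi>) auto

lemma val_skeleton: "val v (skeleton f \<phi>) = eval (\<lambda>a. v (f a)) \<phi>"
  by (induction \<phi>) auto

lemma subst_skeleton:
  assumes "\<And>a. a \<in> atoms \<phi> \<Longrightarrow> \<sigma> (f a) = a"
  shows "subst \<sigma> (skeleton f \<phi>) = \<phi>"
  using assms by (induction \<phi>) auto

lemma Luk_bounds: "x \<in> Luk n \<Longrightarrow> 0 \<le> x \<and> x \<le> 1"
  by (cases "n = 0") (auto simp: Luk_def)

lemma eval_in_Luk:
  assumes "n \<ge> 1" "range w \<subseteq> Luk n"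
  shows "eval w \<phi> \<in> Luk n"
proof -
  \<comment> \<open>For this purpose the atoms may be taken as the variables of the language.\<close>
  define enc :: "'a form \<Rightarrow> 'a form form" where
    "enc = rec_form (\<lambda>p. Var (Var p)) (\<lambda>_. Neg) (\<lambda>_ _. Oplus) (\<lambda>\<psi> _. Var (\<box> \<psi>))"
  have "val w (enc \<phi>) = eval w \<phi>" "box_free (enc \<phi>)"
    by (induction \<phi>) (auto simp: enc_def)
  then show ?thesis
    using val_in_Luk[of n w "enc \<phi>"] assms by auto
qed

lemma eval_bounds:
  assumes "n \<ge> 1" "range w \<subseteq> Luk n"
  shows "0 \<le> eval w \<phi>" "eval w \<phi> \<le> 1"
  using Luk_bounds[OF eval_in_Luk[OF assms, of \<phi>]] by auto

lemma eval_Iff_eq_1: "eval w (\<phi> \<^bold>\<leftrightarrow> \<psi>) = 1 \<longleftrightarrow> eval w \<phi> = eval w \<psi>"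
  by (auto simp: min_def)

lemma eval_funpow_Imp:
  assumes "eval w \<phi> \<le> 1"
  shows "eval w (((\<lambda>\<chi>. \<phi> \<^bold>\<rightarrow> \<chi>) ^^ k) \<psi>) \<ge> min 1 (real k * (1 - eval w \<phi>) + eval w \<psi>)"
proof (induction k)
  case (Suc k)
  have "real (Suc k) * (1 - eval w \<phi>) = real k * (1 - eval w \<phi>) + (1 - eval w \<phi>)"
    by (simp add: algebra_simps)
  then show ?case using Suc.IH assms by (simp add: min_def split: if_splits)
qed simp

lemma eval_opow:
  assumes "0 \<le> eval w \<phi>" "eval w \<phi> \<le> 1"
  shows "eval w (opow \<phi> (Suc m)) = max 0 (1 - real (Suc m) * (1 - eval w \<phi>))"
proof (induction m)
  case 0
  then show ?case using assms by (simp add: opow_def)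
next
  case (Suc m)
  have "opow \<phi> (Suc (Suc m)) = \<phi> \<odot> opow \<phi> (Suc m)" by (simp add: opow_def)
  then have step: "eval w (opow \<phi> (Suc (Suc m)))
      = 1 - min ((1 - eval w \<phi>) + (1 - eval w (opow \<phi> (Suc m)))) 1" by simp
  define r where "r = real (Suc m) * (1 - eval w \<phi>)"
  have "r \<ge> 0" using assms by (simp add: r_def)
  have "real (Suc (Suc m)) * (1 - eval w \<phi>) = r + (1 - eval w \<phi>)"
    by (simp add: r_def algebra_simps)
  moreover have "eval w (opow \<phi> (Suc m)) = max 0 (1 - r)" using Suc.IH by (simp only: r_def)
  ultimately show ?case
    unfolding step using assms \<open>r \<ge> 0\<close> by (simp only:)
qed

section \<open>Dyadic and threshold terms\<close>

text \<open>The composition of doublings \<open>\<psi> \<mapsto> \<psi> \<oplus> \<psi>\<close> and squarings \<open>\<psi> \<mapsto> \<psi> \<odot> \<psi>\<close> prescribed by the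
  \<open>k\<close> lowest binary digits of \<open>a\<close>, where the digit \<open>0\<close> stands for doubling and the lowest digit
  is applied last.\<close>

primrec dyadic :: "nat \<Rightarrow> nat \<Rightarrow> 'v form \<Rightarrow> 'v form" where
  "dyadic 0 a \<phi> = \<phi>"
| "dyadic (Suc k) a \<phi> =
    (if even a then dyadic k (a div 2) \<phi> \<oplus> dyadic k (a div 2) \<phi>
     else dyadic k (a div 2) \<phi> \<odot> dyadic k (a div 2) \<phi>)"

lemma eval_dyadic:
  assumes "0 \<le> eval w \<phi>" "eval w \<phi> \<le> 1" "a < 2 ^ k"
  shows "eval w (dyadic k a \<phi>) = max 0 (min 1 (2 ^ k * eval w \<phi> - real a))"
  using assms(3)
proof (induction k arbitrary: a)
  case 0
  then show ?case using assms by simp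
next
  case (Suc k)
  define b where "b = a div 2"
  have b: "b < 2 ^ k" using Suc.prems by (auto simp: b_def)
  show ?case
  proof (cases "even a")
    case True
    then have "real a = 2 * real b" by (auto simp: b_def)
    then show ?thesis
      using True Suc.IH[OF b] by (auto simp: b_def[symmetric] min_def max_def)
  next
    case False
    then have "a = 2 * b + 1" by (auto simp: b_def)
    then have "real a = 2 * real b + 1" by simp
    then show ?thesis
      using False Suc.IH[OF b] by (auto simp: b_def[symmetric] min_def max_def)
  qed
qed

text \<open>For \<open>i < n\<close>, a dyadic term that distinguishes the truth values above \<open>i/n\<close> from the others.
  It is \<open>dyadic k a\<close> with \<open>k = n + 1\<close> and \<open>a\<close> the quotient of \<open>i 2^k\<close> by \<open>n\<close>, plus one. The interval
  from \<open>a/2^k\<close> to \<open>(a+1)/2^k\<close> on which the truth function of the dyadic term increases lies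
  between \<open>i/n\<close> and \<open>(i+1)/n\<close>, as this choice of \<open>k\<close> makes \<open>1/n\<close> at least two dyadic steps.\<close>

definition threshold :: "nat \<Rightarrow> nat \<Rightarrow> 'v form \<Rightarrow> 'v form" where
  "threshold n i = dyadic (Suc n) (i * 2 ^ Suc n div n + 1)"

lemma eval_threshold:
  assumes "i < n" "eval w \<phi> \<in> Luk n"
  shows "eval w (threshold n i \<phi>) = (if eval w \<phi> > real i / real n then 1 else 0)"
proof -
  define K :: nat where "K = 2 ^ Suc n"
  define a where "a = i * K div n + 1"
  have n: "n > 0" using assms(1) by simp
  have K: "2 * n \<le> K" using less_exp[of n] by (simp add: K_def)
  have "i * K div n * n \<le> i * K" by simp
  moreover have "i * K < i * K div n * n + n"
    using n by (metis add.commute dividend_less_div_times)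
  ultimately have lo: "i * K \<le> a * n" and "(a + 1) * n \<le> i * K + 2 * n"
    by (auto simp: a_def algebra_simps)
  then have hi: "(a + 1) * n \<le> (i + 1) * K" using K by simp
  also have "\<dots> \<le> K * n" using assms(1) mult_le_mono2[of "i + 1" n K] by (simp add: mult.commute)
  finally have "a + 1 \<le> K" using n mult_le_cancel2[of "a + 1" n K] by blast
  then have aK: "a < K" by simp
  obtain l where l: "eval w \<phi> = real l / real n" using assms(2) by (auto simp: Luk_def)
  have "eval w (threshold n i \<phi>) = max 0 (min 1 (real K * eval w \<phi> - real a))"
    using eval_dyadic[of w \<phi> a "Suc n"] Luk_bounds[OF assms(2)] aK
    by (simp add: threshold_def a_def K_def)
  moreover have "real K * eval w \<phi> - real a \<ge> 1" if "l > i"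
  proof -
    have "(a + 1) * n \<le> K * l"
      using hi that mult_le_mono2[of "i + 1" l K] by (simp add: mult.commute)
    then have "(real a + 1) * real n \<le> real K * real l"
      by (metis of_nat_1 of_nat_add of_nat_le_iff of_nat_mult)
    then show ?thesis using n by (simp add: l field_simps)
  qed
  moreover have "real K * eval w \<phi> - real a \<le> 0" if "l \<le> i"
  proof -
    have "K * l \<le> a * n"
      using le_trans[OF mult_le_mono2[OF that, of K]] lo by (simp add: mult.commute)
    then have "real K * real l \<le> real a * real n"
      by (metis of_nat_le_iff of_nat_mult)
    then show ?thesis using n by (simp add: l field_simps)
  qed
  ultimately show ?thesis using n by (cases "l > i") (simp_all add: l divide_less_cancel)
qed

lemma Luk_eqI:
  assumes "x \<in> Luk n" "y \<in> Luk n"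
    and "\<And>i. i < n \<Longrightarrow> x > real i / real n \<longleftrightarrow> y > real i / real n"
  shows "x = y"
proof -
  obtain k l where kl: "k \<le> n" "x = real k / real n" "l \<le> n" "y = real l / real n"
    using assms(1,2) unfolding Luk_def by blast
  show ?thesis
    using assms(3)[of k] assms(3)[of l] kl
    by (cases k l rule: linorder_cases) (auto simp: divide_less_cancel)
qed

lemma monotone_threshold:
  assumes "n \<ge> 1" "i < n" "mono g" "g 0 = 0" "g 1 = (1 :: real)"
  obtains j where "j < n"
    "\<And>x. x \<in> Luk n \<Longrightarrow> g x > real i / real n \<longleftrightarrow> x > real j / real n"
proof -
  \<comment> \<open>By monotonicity, \<open>J\<close> is an initial segment of \<open>{..n}\<close>.\<close>
  define J where "J = {j. j \<le> n \<and> g (real j / real n) \<le> real i / real n}"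
  have J: "finite J" "0 \<in> J" using assms by (auto simp: J_def)
  define j where "j = Max J"
  have jJ: "j \<in> J" using J Max_in by (auto simp: j_def)
  have "j \<noteq> n" using jJ assms by (auto simp: J_def field_simps)
  then have "j < n" using jJ by (simp add: J_def)
  moreover have "g x > real i / real n \<longleftrightarrow> x > real j / real n" if x: "x \<in> Luk n" for x
  proof -
    obtain l where l: "l \<le> n" "x = real l / real n" using x by (auto simp: Luk_def)
    show ?thesis
    proof (cases "l \<le> j")
      case True
      then have "x \<le> real j / real n" by (simp add: l divide_right_mono)
      then have "g x \<le> g (real j / real n)" using assms(3) by (rule monoD[rotated])
      then show ?thesis using jJ \<open>x \<le> _\<close> by (auto simp: J_def)
    next
      case False
      then have "l \<notin> J" using Max_ge[OF J(1)] by (auto simp: j_def)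
      then show ?thesis using l False assms(1) by (auto simp: J_def divide_less_cancel)
    qed
  qed
  ultimately show thesis by (rule that)
qed

section \<open>Derivability in a logic with the doubling axioms\<close>

text \<open>A set of formulas with the closure properties and axioms that define \<open>K'_logic n\<close> as a least
  set. The variables are assumed to be infinite in number.\<close>

locale doubling_logic =
  fixes n :: nat and L :: "'v form set"
  assumes infinite_vars: "infinite (UNIV :: 'v set)"
    and n_pos: "n \<ge> 1"
    and mp: "closed_mp L"
    and substitution: "closed_subst L"
    and nec: "closed_nec L"
    and MV_subset: "MV n \<subseteq> L"
    and K_subset: "K_axioms \<subseteq> L"
    and double_subset: "double_axioms \<subseteq> L"
begin

text \<open>As there are infinitely many variables, the finitely many atoms of \<open>\<phi>\<close> can be replaced by
  distinct variables, so that \<open>\<phi>\<close> is a substitution instance of a theorem of \<open>MV n\<close>.\<close>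

lemma tautology_in:
  assumes "\<And>w. range w \<subseteq> Luk n \<Longrightarrow> eval w \<phi> = 1"
  shows "\<phi> \<in> L"
proof -
  obtain V :: "'v set" where "finite V" "card V = card (atoms \<phi>)"
    using infinite_arbitrarily_large[OF infinite_vars] by blast
  then obtain f where "bij_betw f (atoms \<phi>) V"
    using finite_same_card_bij[OF finite_atoms] by metis
  then have f: "inj_on f (atoms \<phi>)" by (simp add: bij_betw_def)
  have "skeleton f \<phi> \<in> MV n"
    using assms by (simp add: MV_def box_free_skeleton val_skeleton image_subset_iff)
  then have "subst (inv_into (atoms \<phi>) f) (skeleton f \<phi>) \<in> L"
    using MV_subset substitution by (auto simp: closed_subst_def)
  then show ?thesis using f by (simp add: subst_skeleton)
qed

lemma funpow_Imp_detach:
  assumes "\<phi> \<in> L" "((\<lambda>\<chi>. \<phi> \<^bold>\<rightarrow> \<chi>) ^^ k) \<psi> \<in> L"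
  shows "\<psi> \<in> L"
  using assms(2)
proof (induction k)
  case (Suc k)
  then have "(\<phi> \<^bold>\<rightarrow> ((\<lambda>\<chi>. \<phi> \<^bold>\<rightarrow> \<chi>) ^^ k) \<psi>) \<in> L" by simp
  then show ?case using Suc.IH mp assms(1) unfolding closed_mp_def by blast
qed simp

text \<open>A premise below \<open>1\<close> is at most \<open>1 - 1/n\<close>, so using each premise \<open>n\<close> times turns
  consequence into validity of an iterated implication.\<close>

lemma consequence_closed:
  assumes "finite \<Gamma>" "\<Gamma> \<subseteq> L"
    and "\<And>w. range w \<subseteq> Luk n \<Longrightarrow> \<forall>\<gamma> \<in> \<Gamma>. eval w \<gamma> = 1 \<Longrightarrow> eval w \<phi> = 1"
  shows "\<phi> \<in> L"
  using assms
proof (induction arbitrary: \<phi> rule: finite_induct)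
  case empty
  then show ?case using tautology_in by blast
next
  case (insert \<gamma> \<Gamma>)
  let ?\<psi> = "((\<lambda>\<chi>. \<gamma> \<^bold>\<rightarrow> \<chi>) ^^ n) \<phi>"
  have "?\<psi> \<in> L"
  proof (rule insert.IH)
    show "\<Gamma> \<subseteq> L" using insert.prems by simp
    fix w assume w: "range w \<subseteq> Luk n" and \<Gamma>: "\<forall>\<gamma> \<in> \<Gamma>. eval w \<gamma> = 1"
    note bounds = eval_bounds[OF n_pos w]
    have lower: "eval w ?\<psi> \<ge> min 1 (real n * (1 - eval w \<gamma>) + eval w \<phi>)"
      by (intro eval_funpow_Imp bounds)
    have "real n * (1 - eval w \<gamma>) + eval w \<phi> \<ge> 1"
    proof (cases "eval w \<gamma> = 1")
      case True
      then show ?thesis using insert.prems(2)[OF w] \<Gamma> by auto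
    next
      case False
      obtain k where k: "k \<le> n" "eval w \<gamma> = real k / real n"
        using eval_in_Luk[OF n_pos w, of \<gamma>] by (auto simp: Luk_def)
      then have "k + 1 \<le> n" using False n_pos by (cases "k = n") auto
      then have "real n * (1 - eval w \<gamma>) \<ge> 1"
        using n_pos k by (simp add: right_diff_distrib)
      then show ?thesis using bounds(1)[of \<phi>] by linarith
    qed
    then show "eval w ?\<psi> = 1" using lower bounds(2)[of ?\<psi>] by linarith
  qed
  then show ?case using funpow_Imp_detach insert.prems(1) by blast
qed

lemma Iff_trans:
  assumes "(\<phi> \<^bold>\<leftrightarrow> \<psi>) \<in> L" "(\<psi> \<^bold>\<leftrightarrow> \<chi>) \<in> L"
  shows "(\<phi> \<^bold>\<leftrightarrow> \<chi>) \<in> L"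
proof (rule consequence_closed)
  show "{\<phi> \<^bold>\<leftrightarrow> \<psi>, \<psi> \<^bold>\<leftrightarrow> \<chi>} \<subseteq> L" using assms by blast
qed (simp_all only: eval_Iff_eq_1 ball_simps finite.intros)

lemma Iff_consequence:
  assumes "(\<phi> \<^bold>\<leftrightarrow> \<psi>) \<in> L" "\<And>w. eval w \<phi> = eval w \<psi> \<Longrightarrow> eval w \<chi> = 1"
  shows "\<chi> \<in> L"
proof (rule consequence_closed)
  show "{\<phi> \<^bold>\<leftrightarrow> \<psi>} \<subseteq> L" using assms(1) by blast
qed (simp_all only: eval_Iff_eq_1 ball_simps finite.intros assms(2))

lemma Iff_sym:
  assumes "(\<phi> \<^bold>\<leftrightarrow> \<psi>) \<in> L"
  shows "(\<psi> \<^bold>\<leftrightarrow> \<phi>) \<in> L"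
  by (rule Iff_consequence[OF assms]) (simp only: eval_Iff_eq_1)

lemma Box_Imp:
  assumes "(\<phi> \<^bold>\<rightarrow> \<psi>) \<in> L"
  shows "(\<box> \<phi> \<^bold>\<rightarrow> \<box> \<psi>) \<in> L"
proof -
  obtain p q :: 'v where "p \<noteq> q"
    using ex_new_if_finite[OF infinite_vars, of "{undefined}"] by fastforce
  then have "(\<box> (Var p \<^bold>\<rightarrow> Var q) \<^bold>\<rightarrow> (\<box> Var p \<^bold>\<rightarrow> \<box> Var q)) \<in> L"
    using K_subset by (auto simp: K_axioms_def)
  then have "subst ((\<lambda>_. \<phi>)(q := \<psi>)) (\<box> (Var p \<^bold>\<rightarrow> Var q) \<^bold>\<rightarrow> (\<box> Var p \<^bold>\<rightarrow> \<box> Var q)) \<in> L"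
    using substitution unfolding closed_subst_def by blast
  then have "(\<box> (\<phi> \<^bold>\<rightarrow> \<psi>) \<^bold>\<rightarrow> (\<box> \<phi> \<^bold>\<rightarrow> \<box> \<psi>)) \<in> L" using \<open>p \<noteq> q\<close> by simp
  moreover have "\<box> (\<phi> \<^bold>\<rightarrow> \<psi>) \<in> L" using nec assms by (auto simp: closed_nec_def)
  ultimately show ?thesis using mp unfolding closed_mp_def by blast
qed

lemma Box_Iff:
  assumes "(\<phi> \<^bold>\<leftrightarrow> \<psi>) \<in> L"
  shows "(\<box> \<phi> \<^bold>\<leftrightarrow> \<box> \<psi>) \<in> L"
proof (rule consequence_closed)
  have "(\<phi> \<^bold>\<rightarrow> \<psi>) \<in> L" "(\<psi> \<^bold>\<rightarrow> \<phi>) \<in> L"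
    by (rule Iff_consequence[OF assms], simp)+
  then show "{\<box> \<phi> \<^bold>\<rightarrow> \<box> \<psi>, \<box> \<psi> \<^bold>\<rightarrow> \<box> \<phi>} \<subseteq> L"
    using Box_Imp by simp
  fix w assume "\<forall>\<gamma> \<in> {\<box> \<phi> \<^bold>\<rightarrow> \<box> \<psi>, \<box> \<psi> \<^bold>\<rightarrow> \<box> \<phi>}. eval w \<gamma> = 1"
  then have "eval w (\<box> \<phi>) = eval w (\<box> \<psi>)"
    by (simp add: min_def split: if_splits)
  then show "eval w (\<box> \<phi> \<^bold>\<leftrightarrow> \<box> \<psi>) = 1" unfolding eval_Iff_eq_1 .
qed simp

lemma Box_double:
  "(\<box> (\<phi> \<oplus> \<phi>) \<^bold>\<leftrightarrow> (\<box> \<phi> \<oplus> \<box> \<phi>)) \<in> L"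
  "(\<box> (\<phi> \<odot> \<phi>) \<^bold>\<leftrightarrow> (\<box> \<phi> \<odot> \<box> \<phi>)) \<in> L"
proof -
  fix p :: 'v
  have inst: "subst (\<lambda>_. \<phi>) \<psi> \<in> L" if "\<psi> \<in> double_axioms" for \<psi>
    using that double_subset substitution unfolding closed_subst_def by blast
  show "(\<box> (\<phi> \<oplus> \<phi>) \<^bold>\<leftrightarrow> (\<box> \<phi> \<oplus> \<box> \<phi>)) \<in> L"
    using inst[of "\<box> (Var p \<oplus> Var p) \<^bold>\<leftrightarrow> (\<box> Var p \<oplus> \<box> Var p)"] by (auto simp: double_axioms_def)
  show "(\<box> (\<phi> \<odot> \<phi>) \<^bold>\<leftrightarrow> (\<box> \<phi> \<odot> \<box> \<phi>)) \<in> L"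
    using inst[of "\<box> (Var p \<odot> Var p) \<^bold>\<leftrightarrow> (\<box> Var p \<odot> \<box> Var p)"] by (auto simp: double_axioms_def)
qed

lemma Iff_double:
  assumes "(\<phi> \<^bold>\<leftrightarrow> \<psi>) \<in> L"
  shows "(\<phi> \<oplus> \<phi> \<^bold>\<leftrightarrow> \<psi> \<oplus> \<psi>) \<in> L" "(\<phi> \<odot> \<phi> \<^bold>\<leftrightarrow> \<psi> \<odot> \<psi>) \<in> L"
proof -
  show "(\<phi> \<oplus> \<phi> \<^bold>\<leftrightarrow> \<psi> \<oplus> \<psi>) \<in> L"
    by (rule Iff_consequence[OF assms]) (simp only: eval_Iff_eq_1 eval.simps(3))
  show "(\<phi> \<odot> \<phi> \<^bold>\<leftrightarrow> \<psi> \<odot> \<psi>) \<in> L"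
    by (rule Iff_consequence[OF assms]) (subst eval_Iff_eq_1, simp)
qed

lemma dyadic_commutes: "(\<box> (dyadic k a \<phi>) \<^bold>\<leftrightarrow> dyadic k a (\<box> \<phi>)) \<in> L"
proof (induction k arbitrary: a)
  case 0
  show ?case unfolding dyadic.simps by (rule tautology_in) (simp only: eval_Iff_eq_1)
next
  case (Suc k)
  note IH = Suc.IH[of "a div 2"]
  show ?case
  proof (cases "even a")
    case True
    show ?thesis
      unfolding dyadic.simps if_P[OF True] by (rule Iff_trans[OF Box_double(1) Iff_double(1)[OF IH]])
  next
    case False
    show ?thesis
      unfolding dyadic.simps if_not_P[OF False]
      by (rule Iff_trans[OF Box_double(2) Iff_double(2)[OF IH]])
  qed
qed

section \<open>Boxes commute with monotone terms\<close>

text \<open>Here \<open>t\<close> is any operation on formulas, given by its effect \<open>g\<close> on truth values. Since every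
  \<open>\<tau>\<^sub>i (t \<phi>)\<close> is equivalent to some \<open>\<tau>\<^sub>j \<phi>\<close>, and thresholds commute with the box, \<open>\<box> t \<phi>\<close> and
  \<open>t (\<box> \<phi>)\<close> exceed the same thresholds.\<close>

lemma monotone_term_commutes:
  assumes "mono g" "g 0 = 0" "g 1 = 1"
    and t: "\<And>w \<psi>. range w \<subseteq> Luk n \<Longrightarrow> eval w (t \<psi>) = g (eval w \<psi>)"
  shows "(\<box> (t \<phi>) \<^bold>\<leftrightarrow> t (\<box> \<phi>)) \<in> L"
proof -
  have "\<exists>j. j < n \<and> (\<forall>x \<in> Luk n. g x > real i / real n \<longleftrightarrow> x > real j / real n)"
    if "i < n" for i
    using monotone_threshold[OF n_pos that assms(1-3)] by metis
  then obtain j where j: "\<And>i. i < n \<Longrightarrow> j i < n"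
    "\<And>i x. i < n \<Longrightarrow> x \<in> Luk n \<Longrightarrow> g x > real i / real n \<longleftrightarrow> x > real (j i) / real n"
    by metis
  define E where "E i = (threshold n i (\<box> (t \<phi>)) \<^bold>\<leftrightarrow> threshold n (j i) (\<box> \<phi>))" for i
  have commutes: "(\<box> (threshold n i \<psi>) \<^bold>\<leftrightarrow> threshold n i (\<box> \<psi>)) \<in> L" for i \<psi>
    unfolding threshold_def by (rule dyadic_commutes)
  have threshold_t: "eval w (threshold n i (t \<psi>)) = eval w (threshold n (j i) \<psi>)"
    if "i < n" and w: "range w \<subseteq> Luk n" for i w \<psi>
    using that(1) j(1) j(2)[OF that(1) eval_in_Luk[OF n_pos w]]
    by (simp add: eval_threshold[OF _ eval_in_Luk[OF n_pos w]] t[OF w])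
  have E: "E i \<in> L" if "i < n" for i
  proof -
    have "(threshold n i (t \<phi>) \<^bold>\<leftrightarrow> threshold n (j i) \<phi>) \<in> L"
      by (rule tautology_in) (simp only: eval_Iff_eq_1 threshold_t[OF that])
    then show ?thesis
      unfolding E_def by (rule Iff_trans[OF Iff_sym[OF commutes] Iff_trans[OF Box_Iff commutes]])
  qed
  show ?thesis
  proof (rule consequence_closed[of "E ` {..<n}"])
    show "E ` {..<n} \<subseteq> L" using E by auto
    fix w assume w: "range w \<subseteq> Luk n" and "\<forall>\<gamma> \<in> E ` {..<n}. eval w \<gamma> = 1"
    then have "eval w (E i) = 1" if "i < n" for i using that by blast
    then have *: "eval w (threshold n i (\<box> (t \<phi>))) = eval w (threshold n i (t (\<box> \<phi>)))"
      if "i < n" for i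
      using that by (simp only: E_def eval_Iff_eq_1 threshold_t[OF that w])
    note Luk = eval_in_Luk[OF n_pos w]
    have "eval w (\<box> (t \<phi>)) = eval w (t (\<box> \<phi>))"
    proof (rule Luk_eqI[OF Luk Luk])
      fix i assume "i < n"
      then show "eval w (\<box> (t \<phi>)) > real i / real n \<longleftrightarrow> eval w (t (\<box> \<phi>)) > real i / real n"
        using *[of i] by (simp only: eval_threshold[OF _ Luk]) (auto split: if_splits)
    qed
    then show "eval w (\<box> (t \<phi>) \<^bold>\<leftrightarrow> t (\<box> \<phi>)) = 1" unfolding eval_Iff_eq_1 .
  qed simp
qed

lemma power_axioms_subset: "power_axioms \<subseteq> L"
proof -
  have "(\<box> (\<phi> \<oplus> opow \<phi> (Suc m)) \<^bold>\<leftrightarrow> (\<box> \<phi> \<oplus> opow (\<box> \<phi>) (Suc m))) \<in> L" for \<phi> m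
  proof (rule monotone_term_commutes[where t = "\<lambda>\<psi>. \<psi> \<oplus> opow \<psi> (Suc m)"
        and g = "\<lambda>x. min (x + max 0 (1 - real (Suc m) * (1 - x))) 1"])
    show "mono (\<lambda>x. min (x + max 0 (1 - real (Suc m) * (1 - x))) 1)"
      by (intro monoI min.mono add_mono max.mono diff_mono mult_left_mono) auto
    fix w :: "'v form \<Rightarrow> real" and \<psi>
    assume "range w \<subseteq> Luk n"
    then show "eval w (\<psi> \<oplus> opow \<psi> (Suc m))
        = min (eval w \<psi> + max 0 (1 - real (Suc m) * (1 - eval w \<psi>))) 1"
      using eval_opow[of w \<psi> m] eval_bounds[OF n_pos, of w \<psi>] by simp
  qed auto
  then show ?thesis
    unfolding power_axioms_def by (auto dest!: Suc_le_D)
qed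

lemma luk_axioms_subset: "luk_axioms \<subseteq> L"
proof
  fix \<phi> :: "'v form" assume "\<phi> \<in> luk_axioms"
  then show "\<phi> \<in> L"
  proof (intro tautology_in)
    fix w :: "'v form \<Rightarrow> real" assume "range w \<subseteq> Luk n"
    then have bounds: "0 \<le> w a" "w a \<le> 1" for a using Luk_bounds[of "w a"] by auto
    then have "1 \<le> w a \<longleftrightarrow> w a = 1" for a by (simp add: order_eq_iff)
    then show "eval w \<phi> = 1"
      using bounds \<open>\<phi> \<in> luk_axioms\<close>
      by (auto simp: luk_axioms_def min_def)
  qed
qed

lemma modal_mv_logic: "modal_mv_logic L"
  unfolding modal_mv_logic_def
  using mp substitution nec luk_axioms_subset K_subset double_subset power_axioms_subset by blast

end

section \<open>Equality of the two logics\<close>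

lemma base_subset_prop_theorems: "B \<subseteq> prop_theorems B"
  unfolding prop_theorems_def by blast

lemma prop_theorems_subset:
  assumes "B \<subseteq> L" "closed_mp L" "closed_subst L"
  shows "prop_theorems B \<subseteq> L"
  using assms unfolding prop_theorems_def closed_subst_def by blast

theorem proposition6p3:
  fixes n :: nat and B :: "'v form set"
  assumes "infinite (UNIV :: 'v set)"
    and "n \<ge> 1"
    and "axiomatic_base n B"
  shows "K_logic B = K'_logic n"
proof
  have MV: "prop_theorems B = MV n" using assms(3) by (simp add: axiomatic_base_def)
  interpret doubling_logic n "K'_logic n :: 'v form set"
    by unfold_locales (intro assms(1,2) K'_logic_closed)+
  have "B \<subseteq> K'_logic n" using base_subset_prop_theorems MV MV_subset by blast
  then show "K_logic B \<subseteq> K'_logic n"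
    using modal_mv_logic unfolding K_logic_def by blast
  have K: "modal_mv_logic (K_logic B)" by (rule modal_mv_logic_K_logic)
  then have "MV n \<subseteq> K_logic B"
    using prop_theorems_subset[OF K_logic_base] MV by (auto simp: modal_mv_logic_def)
  then show "K'_logic n \<subseteq> K_logic B"
    using K unfolding K'_logic_def modal_mv_logic_def by blast
qed

end
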